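(* Let $(X,\rho)$ be a metric space and let $T:X\to CB(X)$ be a multivalued mapping without fixed points (i.e. there is no $x\in X$ with $x\in Tx$). If $T$ does not possess periodic points of prime period $2$, then $T$ has the property of forming a triangle.
   Context: For a metric space $(X,\rho)$, $CB(X)$ denotes the class of all nonempty closed and bounded subsets of $X$, and $H$ is the Pompeiu–Hausdorff metric on $CB(X)$ induced by $\rho$: $H(A,B)=\max\{\sup_{a\in A}\rho(a,B),\ \sup_{b\in B}\rho(b,A)\}$, where $\rho(a,B)=\inf_{b\in B}\rho(a,b)$. For a multivalued mapping $T$ on $X$, the iterates are $T^1x=Tx$ and $T^{n+1}x=\bigcup_{w\in T^n x}Tw$. A point $x\in X$ is a periodic point of period $n$ (with $n\ge 1$) if $x\in T^nx$; the prime period of $x$ is the smallest positive integer $n$ for which $x\in T^nx$. A multivalued mapping $T:X\to CB(X)$ has the property of forming a triangle if for all $x\in X$, all $y\in Tx$ with $x\neq y$, and all $\alpha>0$, there exists $z\in Ty$ with $H(Tx,Tz)>0$ such that $\rho(y,z)\leq H(Tx,Ty)+\alpha$. *)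

theory Defs
  imports "HOL-Analysis.Analysis"
begin

definition CB :: "'a::metric_space set set"
  where "CB = {A. A \<noteq> {} \<and> closed A \<and> bounded A}"

(* Both suprema are over real sets; they are genuine (the images are nonempty and
   bounded above) when A and B are in CB. *)
definition hausdorff :: "'a::metric_space set \<Rightarrow> 'a set \<Rightarrow> real"
  where "hausdorff A B = max (SUP a\<in>A. infdist a B) (SUP b\<in>B. infdist b A)"

(* Started at exponent 0 with {x}, so that exponent 1 gives T x. *)
primrec mv_iter :: "('a \<Rightarrow> 'a set) \<Rightarrow> nat \<Rightarrow> 'a \<Rightarrow> 'a set"
  where
    "mv_iter T 0 x = {x}"
  | "mv_iter T (Suc n) x = (\<Union>w\<in>mv_iter T n x. T w)"

lemma mv_iter_1: "mv_iter T 1 x = T x"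
  by simp

definition periodic_point :: "('a \<Rightarrow> 'a set) \<Rightarrow> nat \<Rightarrow> 'a \<Rightarrow> bool"
  where "periodic_point T n x \<longleftrightarrow> n \<ge> 1 \<and> x \<in> mv_iter T n x"

definition prime_period :: "('a \<Rightarrow> 'a set) \<Rightarrow> nat \<Rightarrow> 'a \<Rightarrow> bool"
  where "prime_period T n x \<longleftrightarrow>
    periodic_point T n x \<and> (\<forall>m. periodic_point T m x \<longrightarrow> n \<le> m)"

definition forms_triangle :: "('a::metric_space \<Rightarrow> 'a set) \<Rightarrow> bool"
  where "forms_triangle T \<longleftrightarrow>
    (\<forall>x. \<forall>y\<in>T x. x \<noteq> y \<longrightarrow> (\<forall>\<alpha>>0. \<exists>z\<in>T y.
       hausdorff (T x) (T z) > 0 \<and> dist y z \<le> hausdorff (T x) (T y) + \<alpha>))"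

end

theory Submission
  imports Defs
begin

text \<open>Given \<open>y \<in> T x\<close>, choose \<open>z \<in> T y\<close> almost realising the distance from \<open>y\<close> to \<open>T y\<close>.
  Then \<open>y \<notin> T z\<close>, since otherwise \<open>y\<close> would be periodic of period 2, and even of prime period 2
  as \<open>T\<close> has no fixed points. So \<open>T x\<close> contains a point at positive distance from the closed
  set \<open>T z\<close>.\<close>

lemma infdist_le_hausdorff:
  assumes "bounded A" "B \<noteq> {}" "a \<in> A"
  shows "infdist a B \<le> hausdorff A B"
proof -
  \<comment> \<open>Distances to one fixed \<open>b\<close> dominate \<open>infdist x B\<close>
    uniformly on the bounded set \<open>A\<close>, so the real supremum in \<open>hausdorff\<close>
    really is an upper bound.\<close>
  obtain b where b: "b \<in> B" using assms(2) by blast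
  obtain r where r: "\<And>x. x \<in> A \<Longrightarrow> dist b x \<le> r"
    using assms(1) bounded_any_center by metis
  have "infdist x B \<le> r" if "x \<in> A" for x
    using infdist_le2[OF b, of x r] r[OF that] by (simp add: dist_commute)
  then have "bdd_above ((\<lambda>x. infdist x B) ` A)" by (rule bdd_aboveI2)
  then have "infdist a B \<le> (SUP x\<in>A. infdist x B)"
    using assms(3) by (rule cSUP_upper2) simp
  then show ?thesis by (simp add: hausdorff_def le_max_iff_disj)
qed

lemma infdist_approx:
  assumes "A \<noteq> {}" "infdist x A < r"
  obtains a where "a \<in> A" "dist x a < r"
  using assms by (auto simp: infdist_notempty cINF_less_iff)

text \<open>The only smaller candidate period is 1, which would mean
  \<open>y \<in> T y\<close>.\<close>

lemma prime_period_2I: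
  assumes "z \<in> T y" "y \<in> T z" "y \<notin> T y"
  shows "prime_period T 2 y"
proof -
  have "2 \<le> m" if "periodic_point T m y" for m
  proof -
    have "m \<noteq> 1" using that assms(3) by (auto simp: periodic_point_def)
    then show ?thesis using that by (simp add: periodic_point_def)
  qed
  moreover have "periodic_point T 2 y"
    using assms(1,2) by (auto simp: periodic_point_def numeral_2_eq_2)
  ultimately show ?thesis by (simp add: prime_period_def)
qed

theorem lemma1:
  fixes T :: "'a::metric_space \<Rightarrow> 'a set"
  assumes "\<And>x. T x \<in> CB"
    and "\<not> (\<exists>x. x \<in> T x)"
    and "\<not> (\<exists>x. prime_period T 2 x)"
  shows "forms_triangle T"
  unfolding forms_triangle_def
proof (intro allI ballI impI)
  fix x y and \<alpha> :: real
  assume y: "y \<in> T x" and \<alpha>: "\<alpha> > 0"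
  have CB: "T u \<noteq> {}" "closed (T u)" "bounded (T u)" for u
    using assms(1)[of u] by (auto simp: CB_def)
  \<comment> \<open>The infimum over \<open>T y\<close> need not be attained; the slack
    \<open>\<alpha>\<close> makes the bound strict, so some \<open>z\<close> still lies below
    it.\<close>
  have "infdist y (T y) < hausdorff (T x) (T y) + \<alpha>"
    using infdist_le_hausdorff[OF CB(3) CB(1) y] \<alpha> by (smt (verit))
  then obtain z where z: "z \<in> T y" "dist y z < hausdorff (T x) (T y) + \<alpha>"
    using infdist_approx[OF CB(1)] by blast
  have "y \<notin> T z" using prime_period_2I[of z T y] z(1) assms(2,3) by blast
  then have "infdist y (T z) > 0" using CB(1,2) infdist_pos_not_in_closed by blast
  also have "\<dots> \<le> hausdorff (T x) (T z)" by (rule infdist_le_hausdorff[OF CB(3) CB(1) y])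
  finally show "\<exists>z\<in>T y. hausdorff (T x) (T z) > 0 \<and> dist y z \<le> hausdorff (T x) (T y) + \<alpha>"
    using z by force
qed

end
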